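(* Let $k$ be a positive integer and let $T$ be a tree rooted at a vertex $x$. Suppose $x$ has children $v_1,\dots,v_d$ (and possibly other children) such that every inclusive-descendant of $v_1,\dots,v_d$ is within distance $\lfloor k/2\rfloor$ of $x$, and there is a leaf $\ell$ that is an inclusive-descendant of $v_1$ at distance exactly $\lfloor k/2\rfloor$ from $x$. Let $T_1$ be the tree obtained from $T$ by deleting $v_2,\dots,v_d$, all descendants of $v_2,\dots,v_d$, and all descendants of $v_1$ except those on the $v_1\ell$-path (nothing of $v_1$'s descendants is kept if $v_1=\ell$). Then $\gamma_{all,k}^\infty(T_1)=\gamma_{all,k}^\infty(T)$.
   Context: The inclusive-descendants of a vertex $v$ in a rooted tree are $v$ together with all its descendants. Graphs are finite and simple; $d(u,v)$ is graph distance and $N_k[x]=\{v: d(x,v)\le k\}$. A multiset $D$ of vertices of $G$ is a distance-$k$ dominating set if every vertex of $V(G)\setminus D$ is at distance at most $k$ from some element of $D$. Let $\mathbb{D}_{k,q}(G)$ be the set of such multisets of cardinality $q$. $D=\{v_1,\dots,v_q\}$ transforms to $D'=\{u_1,\dots,u_q\}$ if (for some indexing) $u_i\in N_k[v_i]$ for all $i$. An eternal distance-$k$ dominating family is $\mathcal{E}\subseteq\mathbb{D}_{k,q}(G)$ for some $q$ such that for every $D\in\mathcal{E}$ and every vertex $v$ there is $D'\in\mathcal{E}$ with $v\in D'$ and $D$ transforms to $D'$. $\gamma_{all,k}^\infty(G)$ is the minimum $q$ for which such a family exists. *)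

theory Defs
  imports "Graph_Theory.Graph_Theory" "HOL-Library.Multiset"
begin

text \<open>
  A finite simple undirected graph is a digraph satisfying the library predicate
  \<^const>\<open>graph\<close>: finite, loop-free, without parallel arcs, and symmetric, so that an undirected
  edge is a pair of opposite arcs.
\<close>

text \<open>
  The library notion \<^const>\<open>tree\<close> is not the one for undirected graphs: in a symmetric digraph
  every edge traversed back and forth counts as a \<^const>\<open>pre_digraph.cycle\<close> of length 2. An
  undirected cycle is a cycle of length at least 3.
\<close>

definition undirected_tree :: "('a,'b) pre_digraph \<Rightarrow> bool" where
  "undirected_tree G \<longleftrightarrow>
     graph G \<and> connected G \<and> \<not> (\<exists>p. pre_digraph.cycle G p \<and> length p \<ge> 3)"

definition rooted_tree :: "('a,'b) pre_digraph \<Rightarrow> 'a \<Rightarrow> bool" where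
  "rooted_tree G r \<longleftrightarrow> undirected_tree G \<and> r \<in> verts G"

definition leaf :: "('a,'b) pre_digraph \<Rightarrow> 'a \<Rightarrow> bool" where
  "leaf G v \<longleftrightarrow> v \<in> verts G \<and> out_degree G v = 1"

text \<open>In a tree the path from \<open>u\<close> to \<open>v\<close> is unique, and this is its set of vertices.\<close>

definition path_verts :: "('a,'b) pre_digraph \<Rightarrow> 'a \<Rightarrow> 'a \<Rightarrow> 'a set" where
  "path_verts G u v =
     {w. \<exists>p. pre_digraph.apath G u p v \<and> w \<in> set (pre_digraph.awalk_verts G u p)}"

definition descendants :: "('a,'b) pre_digraph \<Rightarrow> 'a \<Rightarrow> 'a \<Rightarrow> 'a set" where
  "descendants G r v = {w. w \<noteq> v \<and> v \<in> path_verts G r w}"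

definition inclusive_descendants :: "('a,'b) pre_digraph \<Rightarrow> 'a \<Rightarrow> 'a \<Rightarrow> 'a set" where
  "inclusive_descendants G r v = insert v (descendants G r v)"

definition children :: "('a,'b) pre_digraph \<Rightarrow> 'a \<Rightarrow> 'a \<Rightarrow> 'a set" where
  "children G r v = {w \<in> descendants G r v. v \<rightarrow>\<^bsub>G\<^esub> w}"

text \<open>The value is \<open>\<infinity>\<close> for vertices in different components.\<close>

definition graph_dist :: "('a,'b) pre_digraph \<Rightarrow> 'a \<Rightarrow> 'a \<Rightarrow> ereal" where
  "graph_dist G u v = wf_digraph.\<mu> G (\<lambda>_. 1) u v"

definition closed_nbhd :: "('a,'b) pre_digraph \<Rightarrow> nat \<Rightarrow> 'a \<Rightarrow> 'a set" where
  "closed_nbhd G k u = {v \<in> verts G. graph_dist G u v \<le> ereal (real k)}"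

definition dist_dominating :: "('a,'b) pre_digraph \<Rightarrow> nat \<Rightarrow> 'a multiset \<Rightarrow> bool" where
  "dist_dominating G k D \<longleftrightarrow> set_mset D \<subseteq> verts G \<and>
     (\<forall>v \<in> verts G - set_mset D. \<exists>u \<in># D. graph_dist G v u \<le> ereal (real k))"

definition dist_dominating_sets :: "('a,'b) pre_digraph \<Rightarrow> nat \<Rightarrow> nat \<Rightarrow> 'a multiset set" where
  "dist_dominating_sets G k q = {D. dist_dominating G k D \<and> size D = q}"

text \<open>
  By definition of \<^const>\<open>rel_mset\<close>, this says that \<open>D\<close> and \<open>D'\<close> can be listed as
  \<open>v\<^sub>1, \<dots>, v\<^sub>q\<close> and \<open>u\<^sub>1, \<dots>, u\<^sub>q\<close> with each \<open>u\<^sub>i\<close> in the closed \<open>k\<close>-neighbourhood of \<open>v\<^sub>i\<close>.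
\<close>

definition transforms_to ::
    "('a,'b) pre_digraph \<Rightarrow> nat \<Rightarrow> 'a multiset \<Rightarrow> 'a multiset \<Rightarrow> bool" where
  "transforms_to G k D D' \<longleftrightarrow> rel_mset (\<lambda>v u. u \<in> closed_nbhd G k v) D D'"

text \<open>
  Nonemptiness is required: the empty family would satisfy the closure condition vacuously
  and make the parameter below identically \<open>0\<close>.
\<close>

definition eternal_family ::
    "('a,'b) pre_digraph \<Rightarrow> nat \<Rightarrow> nat \<Rightarrow> 'a multiset set \<Rightarrow> bool" where
  "eternal_family G k q \<E> \<longleftrightarrow> \<E> \<noteq> {} \<and> \<E> \<subseteq> dist_dominating_sets G k q \<and>
     (\<forall>D \<in> \<E>. \<forall>v \<in> verts G. \<exists>D' \<in> \<E>. v \<in># D' \<and> transforms_to G k D D')"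

definition eternal_dom_number :: "('a,'b) pre_digraph \<Rightarrow> nat \<Rightarrow> nat" where
  "eternal_dom_number G k = (LEAST q. \<exists>\<E>. eternal_family G k q \<E>)"

text \<open>The minimum is attained, as placing one guard on every vertex is always eternal.\<close>

lemma eternal_family_exists:
  assumes "graph G"
  shows "\<exists>q \<E>. eternal_family G k q \<E>"
proof -
  interpret graph G by (rule assms)
  let ?D = "mset_set (verts G)"
  have fin: "finite (verts G)" by simp
  have self: "v \<in> closed_nbhd G k v" if "v \<in> verts G" for v
  proof -
    have "awalk v [] v" using that by (simp add: awalk_Nil_iff)
    from min_cost_le_walk_cost[OF this, of "\<lambda>_. 1"] have "\<mu> (\<lambda>_. 1) v v \<le> 0"
      by (simp add: zero_ereal_def)
    also have "0 \<le> ereal (real k)" by simp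
    finally show ?thesis using that by (simp add: closed_nbhd_def graph_dist_def)
  qed
  obtain xs where xs: "mset xs = ?D" using ex_mset by blast
  then have "set xs = verts G" using fin by (metis finite_set_mset_mset_set set_mset_mset)
  then have "list_all2 (\<lambda>v u. u \<in> closed_nbhd G k v) xs xs"
    using self by (auto intro: list.rel_refl_strong)
  then have "transforms_to G k ?D ?D"
    unfolding transforms_to_def rel_mset_def using xs by blast
  then have "eternal_family G k (size ?D) {?D}"
    by (auto simp: eternal_family_def dist_dominating_sets_def dist_dominating_def)
  then show ?thesis by blast
qed

end

theory Submission
  imports Defs
begin

text \<open>
  Two maps from \<open>T\<close> to \<open>T\<^sub>1\<close>, both fixing \<open>T\<^sub>1\<close> pointwise, transport eternal families. Sending all
  deleted vertices to \<open>x\<close> preserves the relation ``at distance at most \<open>k\<close>'', so images of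
  configurations of \<open>T\<close> form a family on \<open>T\<^sub>1\<close>. Sending all deleted vertices to \<open>l\<close> reflects this
  relation, because \<open>l\<close> is at least as far from \<open>x\<close> as any deleted vertex and any two vertices of the
  branches at \<open>v\<^sub>1, \<dots>, v\<^sub>d\<close> are within \<open>k\<close> of each other; so preimages of configurations of \<open>T\<^sub>1\<close> form
  a family on \<open>T\<close>.
\<close>

section \<open>Distance balls described by walks\<close>

context wf_digraph
begin

text \<open>The distance is an infimum over extended reals. Being below \<open>n + 1\<close>, it is
  undercut by the cost of an actual walk, and unit costs add up to an integer, so that walk has
  length at most \<open>n\<close>. From here on, distances are handled through explicit
  walks.\<close>

lemma graph_dist_le_iff:
  "graph_dist G u v \<le> ereal (real n) \<longleftrightarrow> (\<exists>p. awalk u p v \<and> length p \<le> n)"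
proof
  have cost: "awalk_cost (\<lambda>_. 1) p = real (length p)" for p :: "'b list"
    by (induction p) auto
  show "\<exists>p. awalk u p v \<and> length p \<le> n" if "graph_dist G u v \<le> ereal (real n)"
  proof -
    have "\<mu> (\<lambda>_. 1) u v < ereal (real n + 1)"
      using that unfolding graph_dist_def by (rule order_le_less_trans) simp
    then obtain p where "awalk u p v" "awalk_cost (\<lambda>_. 1) p < real n + 1"
      unfolding \<mu>_def by (auto simp: INF_less_iff)
    then show ?thesis using cost[of p] by auto
  qed
  show "graph_dist G u v \<le> ereal (real n)" if "\<exists>p. awalk u p v \<and> length p \<le> n"
  proof -
    from that obtain p where "awalk u p v" "length p \<le> n" by blast
    then show ?thesis
      using min_cost_le_walk_cost[of u p v "\<lambda>_. 1"] cost[of p] unfolding graph_dist_def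
      by (metis ereal_less_eq(3) of_nat_le_iff order_trans)
  qed
qed

lemma closed_nbhd_iff:
  "v \<in> closed_nbhd G k u \<longleftrightarrow> (\<exists>p. awalk u p v \<and> length p \<le> k)"
  unfolding closed_nbhd_def graph_dist_le_iff by (auto dest: awalk_last_in_verts)

lemma self_in_closed_nbhd: "v \<in> verts G \<Longrightarrow> v \<in> closed_nbhd G k v"
  unfolding closed_nbhd_iff by (intro exI[of _ "[]"]) (simp add: awalk_Nil_iff)

text \<open>Loop erasure: prepend the first arc to the path found for the rest; if \<open>u\<close>
  already lies on that path, keep only its part from \<open>u\<close> on. The length bound serves
  distance estimates, the bound on the vertex set serves avoidance and containment
  arguments.\<close>

lemma apath_of_awalk:
  assumes "awalk u p v"
  obtains q where "apath u q v" "length q \<le> length p"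
    "set (awalk_verts u q) \<subseteq> set (awalk_verts u p)"
proof -
  have "\<exists>q. apath u q v \<and> length q \<le> length p \<and> set (awalk_verts u q) \<subseteq> set (awalk_verts u p)"
    using assms
  proof (induction p arbitrary: u)
    case Nil
    then show ?case by (intro exI[of _ "[]"]) (auto simp: awalk_Nil_iff apath_Nil_iff)
  next
    case (Cons e p)
    then have e: "e \<in> arcs G" "tail G e = u" and p: "awalk (head G e) p v"
      by (auto simp: awalk_Cons_iff)
    from Cons.IH[OF p] obtain q where q: "apath (head G e) q v" "length q \<le> length p"
      "set (awalk_verts (head G e) q) \<subseteq> set (awalk_verts (head G e) p)" by blast
    show ?case
    proof (cases "u \<in> set (awalk_verts (head G e) q)")
      case True
      moreover have "awalk (head G e) q v" using q(1) by (simp add: apath_def)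
      ultimately obtain r s where rs: "q = r @ s" "awalk (head G e) r u" "awalk u s v"
        using awalk_decomp by blast
      have "apath u s v"
        using q(1) apath_append_iff[of "head G e" r s v] awends_of_awalk(2)[OF rs(2)]
        unfolding rs(1) by simp
      moreover have "set (awalk_verts u s) \<subseteq> set (awalk_verts (head G e) q)"
        unfolding rs(1) set_awalk_verts_append[OF rs(2,3)] by simp
      moreover have "length s \<le> length q" using rs(1) by simp
      ultimately show ?thesis using q(2,3) by (intro exI[of _ s]) auto
    next
      case False
      then show ?thesis using q e by (intro exI[of _ "e # q"]) (auto simp: apath_Cons_iff)
    qed
  qed
  then show ?thesis using that by blast
qed

lemma closed_nbhd_mono: "v \<in> closed_nbhd G i u \<Longrightarrow> i \<le> j \<Longrightarrow> v \<in> closed_nbhd G j u"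
  unfolding closed_nbhd_iff by (meson le_trans)

lemma closed_nbhd_trans:
  assumes "v \<in> closed_nbhd G i u" "w \<in> closed_nbhd G j v"
  shows "w \<in> closed_nbhd G (i + j) u"
proof -
  from assms obtain p q where "awalk u p v" "length p \<le> i" "awalk v q w" "length q \<le> j"
    unfolding closed_nbhd_iff by blast
  then show ?thesis unfolding closed_nbhd_iff by (intro exI[of _ "p @ q"]) auto
qed

lemma awalk_induce_subgraph_iff:
  assumes "S \<subseteq> verts G"
  shows "pre_digraph.awalk (G \<restriction> S) u p v \<longleftrightarrow> awalk u p v \<and> set (awalk_verts u p) \<subseteq> S"
proof -
  interpret S: wf_digraph "G \<restriction> S" by (rule wellformed_induce_subgraph)
  show ?thesis
  proof (induction p arbitrary: u)
    case Nil
    then show ?case using assms by (auto simp: S.awalk_Nil_iff awalk_Nil_iff)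
  next
    case (Cons e p)
    have "head G e \<in> set (awalk_verts (head G e) p)" if "awalk (head G e) p v"
      by (rule hd_in_awalk_verts(1)[OF that])
    then show ?case using Cons by (auto simp: S.awalk_Cons_iff awalk_Cons_iff)
  qed
qed

end

context sym_digraph
begin

lemma arc_rev:
  assumes "e \<in> arcs G"
  obtains e' where "e' \<in> arcs G" "tail G e' = head G e" "head G e' = tail G e"
  using assms sym_arcs unfolding symmetric_conv by metis

lemma awalk_rev:
  assumes "awalk u p v"
  obtains q where "awalk v q u" "length q = length p"
    "set (awalk_verts v q) = set (awalk_verts u p)"
proof -
  have "\<exists>q. awalk v q u \<and> length q = length p \<and> set (awalk_verts v q) = set (awalk_verts u p)"
    using assms
  proof (induction p arbitrary: u)
    case Nil
    then show ?case by (intro exI[of _ "[]"]) (auto simp: awalk_Nil_iff)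
  next
    case (Cons e p)
    then have e: "e \<in> arcs G" "tail G e = u" and p: "awalk (head G e) p v"
      by (auto simp: awalk_Cons_iff)
    from Cons.IH[OF p] obtain q where q: "awalk v q (head G e)" "length q = length p"
      "set (awalk_verts v q) = set (awalk_verts (head G e) p)" by blast
    obtain e' where e': "e' \<in> arcs G" "tail G e' = head G e" "head G e' = u"
      using arc_rev[OF e(1)] e(2) by metis
    then have w: "awalk (head G e) [e'] u" by (auto simp: awalk_simps)
    have "head G e \<in> set (awalk_verts (head G e) p)" by (rule hd_in_awalk_verts(1)[OF p])
    then have "set (awalk_verts v (q @ [e'])) = set (awalk_verts u (e # p))"
      using set_awalk_verts_append[OF q(1) w] q(3) e e' by auto
    then show ?case using q w by (intro exI[of _ "q @ [e']"]) auto
  qed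
  then show ?thesis using that by blast
qed

lemma closed_nbhd_sym: "v \<in> closed_nbhd G k u \<Longrightarrow> u \<in> closed_nbhd G k v"
  unfolding closed_nbhd_iff by (metis awalk_rev)

end

section \<open>Unique paths and the ancestor order in a tree\<close>

locale rooted_undirected_tree = graph T for T :: "('a,'b) pre_digraph" +
  fixes r :: 'a
  assumes tree: "rooted_tree T r"
begin

lemma root_in_verts: "r \<in> verts T"
  using tree by (simp add: rooted_tree_def)

lemma apath_exists:
  assumes "u \<in> verts T" "v \<in> verts T"
  obtains p where "apath u p v"
proof -
  have "connected T" using tree by (simp add: rooted_tree_def undirected_tree_def)
  then have "strongly_connected T"
    using symmetric_connected_imp_strongly_connected sym_arcs by blast
  then have "u \<rightarrow>\<^sup>*\<^bsub>T\<^esub> v" using assms by (auto simp: strongly_connected_def)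
  then show ?thesis using that reachable_apath by blast
qed

text \<open>If \<open>c\<close> and \<open>c'\<close> differ, the walk shortens to a nonempty path
  avoiding \<open>u\<close>. Closing it up through \<open>u\<close> with the two arcs gives a cycle
  of length at least 3, the kind that a tree excludes; going back and forth along one edge is not
  covered, hence the conclusion \<open>c = c'\<close>.\<close>

lemma no_detour:
  assumes walk: "awalk c p c'" and u: "u \<notin> set (awalk_verts c p)"
    and e: "e \<in> arcs T" "tail T e = u" "head T e = c"
    and e': "e' \<in> arcs T" "tail T e' = c'" "head T e' = u"
  shows "c = c'"
proof (rule ccontr)
  assume "c \<noteq> c'"
  obtain q where q: "apath c q c'" "set (awalk_verts c q) \<subseteq> set (awalk_verts c p)"
    using apath_of_awalk[OF walk] by blast
  then have "q \<noteq> []" using \<open>c \<noteq> c'\<close> by (auto simp: apath_Nil_iff)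
  have w: "awalk c q c'" using q(1) by (simp add: apath_def)
  have w': "awalk c' [e'] u" using e' by (auto simp: awalk_simps)
  have "awalk c (q @ [e']) u" using w w' by auto
  then have "awalk u (e # q @ [e']) u" using e by (auto simp: awalk_Cons_iff)
  moreover have "awalk_verts c (q @ [e']) = awalk_verts c q @ [u]"
    using awalk_verts_append[OF \<open>awalk c (q @ [e']) u\<close>] e' by simp
  then have "distinct (tl (awalk_verts u (e # q @ [e'])))"
    using q u e by (auto simp: apath_def)
  ultimately have "cycle (e # q @ [e'])" unfolding cycle_def by blast
  moreover have "3 \<le> length (e # q @ [e'])" using \<open>q \<noteq> []\<close> by (cases q) auto
  ultimately show False using tree unfolding rooted_tree_def undirected_tree_def by blast
qed

text \<open>Follow one path after its first arc to \<open>v\<close> and return along the reverse of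
  the other. This walk avoids \<open>u\<close>, so by \<open>no_detour\<close> both first arcs have
  the same head; without parallel arcs they are equal, and induction treats the rest.\<close>

lemma apath_unique:
  assumes "apath u p v" "apath u q v"
  shows "p = q"
  using assms
proof (induction p arbitrary: u q)
  case Nil
  then have "u = v" by (simp add: apath_Nil_iff)
  then show ?case using Nil.prems(2) apath_nonempty_ends by (metis apath_def)
next
  case (Cons e p)
  then have e: "e \<in> arcs T" "tail T e = u" "apath (head T e) p v"
    "u \<notin> set (awalk_verts (head T e) p)" by (auto simp: apath_Cons_iff)
  have "u \<noteq> v" using apath_nonempty_ends[OF Cons.prems(1)] by simp
  then obtain f q' where q: "q = f # q'" using Cons.prems(2) by (cases q) (auto simp: apath_Nil_iff)
  with Cons.prems have f: "f \<in> arcs T" "tail T f = u" "apath (head T f) q' v"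
    "u \<notin> set (awalk_verts (head T f) q')" by (auto simp: apath_Cons_iff)
  have w1: "awalk (head T e) p v" "awalk (head T f) q' v" using e f by (auto simp: apath_def)
  obtain s where s: "awalk v s (head T f)"
    "set (awalk_verts v s) = set (awalk_verts (head T f) q')"
    using awalk_rev[OF w1(2)] by blast
  obtain f' where f': "f' \<in> arcs T" "tail T f' = head T f" "head T f' = tail T f"
    using arc_rev[OF f(1)] by blast
  have "awalk (head T e) (p @ s) (head T f)" using w1(1) s(1) by auto
  moreover have "u \<notin> set (awalk_verts (head T e) (p @ s))"
    using set_awalk_verts_append[OF w1(1) s(1)] s(2) e(4) f(4) by simp
  ultimately have "head T e = head T f"
    using no_detour[of "head T e" "p @ s" "head T f" u e f'] e f f' by simp
  moreover from this have "e = f" using e f by (intro no_multi_arcs) (auto simp: arc_to_ends_def)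
  ultimately show ?case using Cons.IH e(3) f(3) q by simp
qed

lemma path_verts_eq: "apath u p v \<Longrightarrow> path_verts T u v = set (awalk_verts u p)"
  unfolding path_verts_def using apath_unique by blast

lemma path_verts_imp_verts:
  assumes "w \<in> path_verts T u v"
  shows "w \<in> verts T" "v \<in> verts T"
  using assms unfolding path_verts_def apath_def by (auto dest: awalk_last_in_verts)

lemma endpoints_in_path_verts:
  assumes "u \<in> verts T" "v \<in> verts T"
  shows "u \<in> path_verts T u v" "v \<in> path_verts T u v"
proof -
  obtain p where p: "apath u p v" using apath_exists[OF assms] .
  then show "u \<in> path_verts T u v" using hd_in_awalk_verts(2) path_verts_eq by blast
  have "awalk u p v" using p by (simp add: apath_def)
  then have "last (awalk_verts u p) = v" by simp
  then show "v \<in> path_verts T u v"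
    unfolding path_verts_eq[OF p] using last_in_set[OF awalk_verts_non_Nil, of u p] by simp
qed

lemma path_verts_decomp:
  assumes "a \<in> path_verts T u v"
  obtains p q where "apath u p a" "apath a q v" "apath u (p @ q) v"
    "path_verts T u v = path_verts T u a \<union> path_verts T a v"
    "path_verts T u a \<inter> path_verts T a v = {a}"
proof -
  obtain s where s: "apath u s v" "a \<in> set (awalk_verts u s)"
    using assms unfolding path_verts_def by blast
  then have "awalk u s v" by (simp add: apath_def)
  then obtain p q where pq: "s = p @ q" "awalk u p a" "awalk a q v"
    using awalk_decomp s(2) by blast
  have ap: "apath u p a" "apath a q v" and
    disj: "set (awalk_verts u p) \<inter> set (tl (awalk_verts a q)) = {}"
    using s(1) apath_append_iff[of u p q v] awends_of_awalk(2)[OF pq(2)] unfolding pq(1) by auto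
  have "set (awalk_verts a q) = insert a (set (tl (awalk_verts a q)))"
    by (metis awalk_verts_non_Nil awends_of_awalk(1) list.exhaust_sel list.simps(15) pq(3))
  moreover have "a \<in> set (awalk_verts u p)"
    using endpoints_in_path_verts(2) path_verts_eq[OF ap(1)] pq(2)
    by (metis awalk_hd_in_verts awalk_last_in_verts)
  ultimately have "path_verts T u a \<inter> path_verts T a v = {a}"
    using disj ap path_verts_eq by auto
  moreover have "path_verts T u v = path_verts T u a \<union> path_verts T a v"
    using set_awalk_verts_append[OF pq(2,3)] s(1) ap path_verts_eq unfolding pq(1) by auto
  ultimately show ?thesis using that ap s(1) pq(1) by blast
qed

text \<open>Read \<open>a \<in> path_verts T u v\<close> as: \<open>a\<close> is an ancestor of
  \<open>v\<close> in the tree rooted at \<open>u\<close>. This lemma is then transitivity;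
  antisymmetry and comparability of two ancestors of the same vertex follow below.\<close>

lemma path_verts_subset: "a \<in> path_verts T u v \<Longrightarrow> path_verts T u a \<subseteq> path_verts T u v"
  by (metis path_verts_decomp Un_upper1)

lemma path_verts_antisym:
  assumes "a \<in> path_verts T u b" "b \<in> path_verts T u a"
  shows "a = b"
proof -
  have "path_verts T u a \<inter> path_verts T a b = {a}"
    using path_verts_decomp[OF assms(1)] by blast
  moreover have "b \<in> path_verts T a b"
    using assms path_verts_imp_verts endpoints_in_path_verts by blast
  ultimately show ?thesis using assms(2) by auto
qed

text \<open>This rewrites a path starting at \<open>a\<close> in terms of the ancestor order from
  \<open>u\<close>; in the theorem it turns the path from \<open>v 1\<close> to \<open>l\<close>
  into a statement about ancestors seen from the root. For the converse direction, a vertex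
  \<open>z\<close> in the first half is an ancestor of \<open>a\<close> as well as a descendant, so
  \<open>z = a\<close>.\<close>

lemma path_verts_iff:
  assumes "a \<in> path_verts T u v"
  shows "z \<in> path_verts T a v \<longleftrightarrow> z \<in> path_verts T u v \<and> a \<in> path_verts T u z"
proof
  obtain p q where pq: "apath u p a" "apath a q v" "apath u (p @ q) v"
    and un: "path_verts T u v = path_verts T u a \<union> path_verts T a v"
    using path_verts_decomp[OF assms] by metis
  have aw: "awalk u p a" "awalk a q v" using pq by (auto simp: apath_def)
  show "z \<in> path_verts T u v \<and> a \<in> path_verts T u z" if z: "z \<in> path_verts T a v"
  proof
    show zuv: "z \<in> path_verts T u v" using un z by blast
    obtain q1 q2 where q: "q = q1 @ q2" "awalk a q1 z" "awalk z q2 v"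
      using awalk_decomp[OF aw(2)] z path_verts_eq[OF pq(2)] by blast
    have w: "awalk u (p @ q1) z" using aw(1) q(2) by auto
    have "apath u (p @ q1) z"
      using pq(3) apath_append_iff[of u "p @ q1" q2 v] awends_of_awalk(2)[OF w]
      unfolding q(1) by simp
    moreover have "a \<in> set (awalk_verts u (p @ q1))"
      using set_awalk_verts_append[OF aw(1) q(2)] hd_in_awalk_verts(1)[OF q(2)] by blast
    ultimately show "a \<in> path_verts T u z" using path_verts_eq by blast
  qed
  show "z \<in> path_verts T a v" if z: "z \<in> path_verts T u v \<and> a \<in> path_verts T u z"
  proof (cases "z \<in> path_verts T u a")
    case True
    then have "z = a" using z path_verts_antisym by blast
    then show ?thesis
      using endpoints_in_path_verts(1) path_verts_imp_verts assms by blast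
  next
    case False
    then show ?thesis using z un by blast
  qed
qed

lemma path_verts_chain:
  assumes "a \<in> path_verts T u v" "b \<in> path_verts T u v"
  shows "a \<in> path_verts T u b \<or> b \<in> path_verts T u a"
  using path_verts_iff[OF assms(1)] path_verts_decomp[OF assms(1)] assms(2) by blast

text \<open>Appending an arc whose head is new leaves a path a path. So along any arc either the
  head is an ancestor of the tail, or the root path grows by exactly one vertex.\<close>

lemma path_verts_arc:
  assumes "e \<in> arcs T" "u \<in> verts T" "head T e \<notin> path_verts T u (tail T e)"
  shows "path_verts T u (head T e) = insert (head T e) (path_verts T u (tail T e))"
proof -
  obtain p where p: "apath u p (tail T e)"
    using apath_exists[OF assms(2) tail_in_verts[OF assms(1)]] .
  then have w: "awalk u p (tail T e)" by (simp add: apath_def)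
  have w': "awalk u (p @ [e]) (head T e)" using w assms(1) by (auto simp: awalk_simps)
  have verts: "awalk_verts u (p @ [e]) = awalk_verts u p @ [head T e]"
    using awalk_verts_append[OF w'] by simp
  have "apath u (p @ [e]) (head T e)"
    using w' p assms(3) unfolding apath_def verts path_verts_eq[OF p] by simp
  from path_verts_eq[OF this] show ?thesis unfolding path_verts_eq[OF p] verts by simp
qed

section \<open>Branches at the root\<close>

lemma inclusive_descendants_eq:
  "c \<in> verts T \<Longrightarrow> inclusive_descendants T r c = {w. c \<in> path_verts T r w}"
  unfolding inclusive_descendants_def descendants_def
  using endpoints_in_path_verts(2)[OF root_in_verts] by auto

lemma child_of_root:
  assumes "c \<in> children T r r"
  shows "c \<in> verts T" "c \<noteq> r" "path_verts T r c = {r, c}"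
proof -
  from assms obtain e where e: "e \<in> arcs T" "tail T e = r" "head T e = c"
    unfolding children_def by auto
  show "c \<in> verts T" using e by auto
  show "c \<noteq> r" using e no_loops by blast
  have "path_verts T r r = {r}"
    using path_verts_eq[of r "[]" r] root_in_verts by (simp add: apath_Nil_iff)
  then show "path_verts T r c = {r, c}"
    using path_verts_arc[OF e(1) root_in_verts] e \<open>c \<noteq> r\<close> by auto
qed

text \<open>If the head were not an ancestor of the tail, its root path would extend that of the
  tail and still contain \<open>c\<close>. So head and \<open>c\<close> are both ancestors of the
  tail, hence comparable, which places the head on the root path \<open>{r, c}\<close> of
  \<open>c\<close>.\<close>

lemma arc_leaving_branch:
  assumes "c \<in> children T r r" "e \<in> arcs T"
    and "c \<in> path_verts T r (tail T e)" "c \<notin> path_verts T r (head T e)"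
  shows "head T e = r"
proof -
  have head: "head T e \<in> path_verts T r (tail T e)"
    using path_verts_arc[OF assms(2) root_in_verts] assms(3,4) by blast
  then have "head T e \<in> {r, c}"
    using path_verts_chain[OF head assms(3)] assms(4) child_of_root(3)[OF assms(1)] by blast
  moreover have "head T e \<noteq> c"
    using assms(4) endpoints_in_path_verts(2)[OF root_in_verts] child_of_root(1)[OF assms(1)]
    by blast
  ultimately show ?thesis by blast
qed

text \<open>The first arc that leaves the branch at \<open>c\<close> ends in the root. The given
  walk itself is cut there, so that the lengths of the two pieces add up to its length.\<close>

lemma awalk_leaving_branch:
  assumes "c \<in> children T r r" "awalk a p b" "c \<in> path_verts T r a" "c \<notin> path_verts T r b"
  obtains p\<^sub>1 p\<^sub>2 where "p = p\<^sub>1 @ p\<^sub>2" "awalk a p\<^sub>1 r" "awalk r p\<^sub>2 b"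
proof -
  have "\<exists>p\<^sub>1 p\<^sub>2. p = p\<^sub>1 @ p\<^sub>2 \<and> awalk a p\<^sub>1 r \<and> awalk r p\<^sub>2 b"
    using assms(2,3)
  proof (induction p arbitrary: a)
    case Nil
    then show ?case using assms(4) by (simp add: awalk_Nil_iff)
  next
    case (Cons e p)
    then have e: "e \<in> arcs T" "tail T e = a" and p: "awalk (head T e) p b"
      by (auto simp: awalk_Cons_iff)
    show ?case
    proof (cases "c \<in> path_verts T r (head T e)")
      case True
      from Cons.IH[OF p True] obtain p\<^sub>1 p\<^sub>2
        where "p = p\<^sub>1 @ p\<^sub>2" "awalk (head T e) p\<^sub>1 r" "awalk r p\<^sub>2 b" by blast
      then show ?thesis
        using e by (intro exI[of _ "e # p\<^sub>1"] exI[of _ p\<^sub>2]) (auto simp: awalk_Cons_iff)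
    next
      case False
      then have "head T e = r" using arc_leaving_branch[OF assms(1) e(1)] e(2) Cons.prems by blast
      then show ?thesis
        using e p by (intro exI[of _ "[e]"] exI[of _ p]) (auto simp: awalk_simps)
    qed
  qed
  then show ?thesis using that by blast
qed

text \<open>A set of vertices closed under ancestors spans a connected subgraph. By uniqueness of
  paths it contains every shortest path between two of its members, so it is isometric.\<close>

lemma closed_nbhd_induce_subgraph:
  assumes S: "S \<subseteq> verts T" and closed: "\<And>w. w \<in> S \<Longrightarrow> path_verts T r w \<subseteq> S"
    and a: "a \<in> S" and b: "b \<in> S"
  shows "b \<in> closed_nbhd (T \<restriction> S) k a \<longleftrightarrow> b \<in> closed_nbhd T k a"
proof -
  interpret S: wf_digraph "T \<restriction> S" by (rule wellformed_induce_subgraph)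
  have "set (awalk_verts a q) \<subseteq> S" if q: "apath a q b" for q
  proof -
    obtain p\<^sub>a p\<^sub>b where p: "apath r p\<^sub>a a" "apath r p\<^sub>b b"
      using apath_exists[OF root_in_verts] a b S by (metis subsetD)
    then have w: "awalk r p\<^sub>a a" "awalk r p\<^sub>b b" by (auto simp: apath_def)
    \<comment> \<open>Going from \<open>a\<close> up to the root and down to \<open>b\<close> visits
      only ancestors of \<open>a\<close> or of \<open>b\<close>, all of them in \<open>S\<close>.
      Loop erasure of this walk yields the unique path \<open>q\<close>.\<close>
    obtain s where s: "awalk a s r" "set (awalk_verts a s) = set (awalk_verts r p\<^sub>a)"
      using awalk_rev[OF w(1)] by blast
    have "awalk a (s @ p\<^sub>b) b" using s(1) w(2) by auto
    then obtain q' where q': "apath a q' b"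
      "set (awalk_verts a q') \<subseteq> set (awalk_verts a (s @ p\<^sub>b))"
      using apath_of_awalk by metis
    have "set (awalk_verts a (s @ p\<^sub>b)) = path_verts T r a \<union> path_verts T r b"
      using set_awalk_verts_append[OF s(1) w(2)] s(2) path_verts_eq p by simp
    then show ?thesis using q' apath_unique[OF q q'(1)] closed a b by blast
  qed
  then show ?thesis
    unfolding S.closed_nbhd_iff closed_nbhd_iff awalk_induce_subgraph_iff[OF S]
    by (meson apath_of_awalk apath_def order_trans)
qed

end

section \<open>Transport of eternal families along vertex maps\<close>

lemma transforms_to_image_mset:
  "transforms_to H k (image_mset f D) (image_mset f D') \<longleftrightarrow>
    rel_mset (\<lambda>a b. f b \<in> closed_nbhd H k (f a)) D D'"
  unfolding transforms_to_def multiset.rel_map ..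

text \<open>An attack on \<open>y\<close> is lifted to an attack on some \<open>w\<close> with
  \<open>f w = y\<close>, and the image of the answer in \<open>G\<close> is the answer in
  \<open>H\<close>. Domination is lifted in the same way, and \<open>pres\<close> keeps every
  guard's move legal.\<close>

lemma eternal_family_image:
  assumes "eternal_family G k q \<E>"
    and surj: "f ` verts G = verts H"
    and pres: "\<And>a b. a \<in> verts G \<Longrightarrow> b \<in> closed_nbhd G k a \<Longrightarrow> f b \<in> closed_nbhd H k (f a)"
  shows "eternal_family H k q (image_mset f ` \<E>)"
proof -
  have E: "\<E> \<noteq> {}" "\<E> \<subseteq> dist_dominating_sets G k q"
    and step: "\<And>D w. D \<in> \<E> \<Longrightarrow> w \<in> verts G \<Longrightarrow> \<exists>D' \<in> \<E>. w \<in># D' \<and> transforms_to G k D D'"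
    using assms(1) unfolding eternal_family_def by blast+
  have sub: "set_mset D \<subseteq> verts G" if "D \<in> \<E>" for D
    using E that by (auto simp: dist_dominating_sets_def dist_dominating_def)
  have "image_mset f D \<in> dist_dominating_sets H k q" if D: "D \<in> \<E>" for D
  proof -
    have "\<exists>u\<in>#image_mset f D. graph_dist H y u \<le> ereal (real k)"
      if "y \<in> verts H - set_mset (image_mset f D)" for y
    proof -
      from that obtain w where w: "w \<in> verts G" "y = f w" "w \<notin># D" using surj by auto
      then obtain u where u: "u \<in># D" "graph_dist G w u \<le> ereal (real k)"
        using E D unfolding dist_dominating_sets_def dist_dominating_def by blast
      then have "u \<in> closed_nbhd G k w" using sub[OF D] by (auto simp: closed_nbhd_def)
      with w pres have "f u \<in> closed_nbhd H k y" by blast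
      then show ?thesis using u by (auto simp: closed_nbhd_def)
    qed
    moreover have "set_mset (image_mset f D) \<subseteq> verts H" using sub[OF D] surj by auto
    moreover have "size D = q" using D E(2) by (auto simp: dist_dominating_sets_def)
    ultimately show ?thesis by (simp add: dist_dominating_sets_def dist_dominating_def)
  qed
  moreover have "\<exists>D' \<in> image_mset f ` \<E>. y \<in># D' \<and> transforms_to H k (image_mset f D) D'"
    if D: "D \<in> \<E>" and y: "y \<in> verts H" for D y
  proof -
    from y obtain w where w: "w \<in> verts G" "y = f w" using surj by auto
    from step[OF D w(1)] obtain D' where D': "D' \<in> \<E>" "w \<in># D'" "transforms_to G k D D'" by blast
    have "transforms_to H k (image_mset f D) (image_mset f D')"
      unfolding transforms_to_image_mset
      by (rule multiset.rel_mono_strong[OF D'(3)[unfolded transforms_to_def]])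
        (use sub[OF D] pres in auto)
    then show ?thesis using D' w by auto
  qed
  ultimately show ?thesis using E(1) unfolding eternal_family_def by auto
qed

text \<open>Here \<open>h\<close> is a retraction onto \<open>verts H\<close>, and a configuration
  of \<open>G\<close> is judged by its image alone. As \<open>h\<close> fixes
  \<open>verts H\<close>, each configuration in the given family is its own image, so the preimage
  family is nonempty.\<close>

lemma eternal_family_preimage:
  assumes "eternal_family H k q \<E>"
    and wf: "wf_digraph H"
    and sub: "verts H \<subseteq> verts G"
    and img: "h ` verts G \<subseteq> verts H"
    and id: "\<And>w. w \<in> verts H \<Longrightarrow> h w = w"
    and refl: "\<And>a b. a \<in> verts G \<Longrightarrow> b \<in> verts G \<Longrightarrow> h b \<in> closed_nbhd H k (h a) \<Longrightarrow>
      b \<in> closed_nbhd G k a"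
  shows "eternal_family G k q {D. set_mset D \<subseteq> verts G \<and> image_mset h D \<in> \<E>}"
    (is "eternal_family _ _ _ ?F")
proof -
  interpret H: wf_digraph H by (rule wf)
  have E: "\<E> \<noteq> {}" "\<E> \<subseteq> dist_dominating_sets H k q"
    and step: "\<And>D w. D \<in> \<E> \<Longrightarrow> w \<in> verts H \<Longrightarrow> \<exists>D' \<in> \<E>. w \<in># D' \<and> transforms_to H k D D'"
    using assms(1) unfolding eternal_family_def by blast+
  have subE: "set_mset D \<subseteq> verts H" if "D \<in> \<E>" for D
    using E that by (auto simp: dist_dominating_sets_def dist_dominating_def)
  have id_mset: "image_mset h D = D" if "set_mset D \<subseteq> verts H" for D
    using that id by (intro trans[OF image_mset_cong[of D h "\<lambda>x. x"]]) auto
  have "?F \<noteq> {}"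
  proof -
    from E(1) obtain D where D: "D \<in> \<E>" by blast
    then have "D \<in> ?F" using subE[OF D] sub id_mset[OF subE[OF D]] by simp
    then show ?thesis by blast
  qed
  moreover have "D \<in> dist_dominating_sets G k q" if D: "D \<in> ?F" for D
  proof -
    have "\<exists>u\<in>#D. graph_dist G w u \<le> ereal (real k)" if w: "w \<in> verts G" for w
    proof -
      have hw: "h w \<in> verts H" using img w by auto
      have "\<exists>u\<in>#image_mset h D. u \<in> closed_nbhd H k (h w)"
      \<comment> \<open>Domination constrains only unoccupied vertices, and \<open>h w\<close> may
        carry a guard of the image although \<open>w\<close> carries none of \<open>D\<close>. In
        that case the guard on \<open>h w\<close> itself is the witness.\<close>
      proof (cases "h w \<in># image_mset h D")
        case True
        then show ?thesis using H.self_in_closed_nbhd[OF hw] by blast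
      next
        case False
        then obtain u where "u \<in># image_mset h D" "graph_dist H (h w) u \<le> ereal (real k)"
          using D E(2) hw unfolding dist_dominating_sets_def dist_dominating_def by blast
        moreover from this(1) have "u \<in> verts H" using D subE by blast
        ultimately show ?thesis by (auto simp: closed_nbhd_def)
      qed
      then obtain u where u: "u \<in># D" "h u \<in> closed_nbhd H k (h w)" by auto
      then have "u \<in> verts G" using D by auto
      from refl[OF w this u(2)] u(1) show ?thesis by (auto simp: closed_nbhd_def)
    qed
    moreover have "size D = q"
    proof -
      have "image_mset h D \<in> dist_dominating_sets H k q" using D E(2) by blast
      then show ?thesis by (simp add: dist_dominating_sets_def)
    qed
    ultimately show ?thesis
      using D by (simp add: dist_dominating_sets_def dist_dominating_def)
  qed
  moreover have "\<exists>D' \<in> ?F. w \<in># D' \<and> transforms_to G k D D'"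
    if D: "D \<in> ?F" and w: "w \<in> verts G" for D w
  proof -
    have "h w \<in> verts H" using img w by auto
    with D step obtain D\<^sub>1 where D\<^sub>1: "D\<^sub>1 \<in> \<E>" "h w \<in># D\<^sub>1" "transforms_to H k (image_mset h D) D\<^sub>1"
      by blast
    \<comment> \<open>The answer in \<open>H\<close> has a guard on \<open>h w\<close>. Placing that
      guard on \<open>w\<close> instead meets the attack and leaves the image under \<open>h\<close>
      unchanged.\<close>
    define D' where "D' = add_mset w (D\<^sub>1 - {#h w#})"
    have "image_mset h (D\<^sub>1 - {#h w#}) = D\<^sub>1 - {#h w#}"
      using subE[OF D\<^sub>1(1)] by (intro id_mset) (auto dest: in_diffD)
    then have img': "image_mset h D' = D\<^sub>1" using D\<^sub>1(2) by (simp add: D'_def)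
    have sub': "set_mset D' \<subseteq> verts G"
      using w subE[OF D\<^sub>1(1)] sub by (auto simp: D'_def dest: in_diffD)
    have "rel_mset (\<lambda>a b. h b \<in> closed_nbhd H k (h a)) D D'"
      using D\<^sub>1(3) unfolding img'[symmetric] transforms_to_image_mset .
    then have "transforms_to G k D D'"
      unfolding transforms_to_def
      by (rule multiset.rel_mono_strong) (use D sub' refl in auto)
    moreover have "w \<in># D'" by (simp add: D'_def)
    ultimately show ?thesis using img' sub' D\<^sub>1(1) by (intro bexI[of _ D']) simp_all
  qed
  ultimately show ?thesis unfolding eternal_family_def by blast
qed

section \<open>Comparison of the tree with its pruned subtree\<close>

theorem theorem4:
  fixes T T\<^sub>1 :: "('a,'b) pre_digraph"
    and x l :: 'a
    and v :: "nat \<Rightarrow> 'a"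
    and d k :: nat
  assumes "k \<ge> 1"
    and "rooted_tree T x"
    and "d \<ge> 1"
    and "inj_on v {1..d}"
    and "\<forall>i\<in>{1..d}. v i \<in> children T x x"
    and "\<forall>i\<in>{1..d}. \<forall>w \<in> inclusive_descendants T x (v i).
           graph_dist T x w \<le> ereal (real (k div 2))"
    and "leaf T l"
    and "l \<in> inclusive_descendants T x (v 1)"
    and "graph_dist T x l = ereal (real (k div 2))"
    and "T\<^sub>1 = T \<restriction> (verts T -
           ((\<Union>i\<in>{2..d}. inclusive_descendants T x (v i)) \<union>
            (descendants T x (v 1) - path_verts T (v 1) l)))"
  shows "eternal_dom_number T\<^sub>1 k = eternal_dom_number T k"
proof -
  interpret graph T using assms(2) by (simp add: rooted_tree_def undirected_tree_def)
  interpret rooted_undirected_tree T x by unfold_locales (rule assms(2))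
  let ?P = "path_verts T x"
  define R where "R = (\<Union>i\<in>{2..d}. inclusive_descendants T x (v i)) \<union>
    (descendants T x (v 1) - path_verts T (v 1) l)"
  define S where "S = verts T - R"
  have T\<^sub>1: "T\<^sub>1 = T \<restriction> S" using assms(10) unfolding R_def S_def .
  have S: "S \<subseteq> verts T" unfolding S_def by blast
  have child: "v i \<in> children T x x" if "i \<in> {1..d}" for i using assms(5) that by blast
  have incl: "inclusive_descendants T x (v i) = {w. v i \<in> ?P w}" if "i \<in> {1..d}" for i
    using inclusive_descendants_eq child_of_root(1)[OF child[OF that]] .
  have one: "1 \<in> {1..d}" using assms(3) by simp
  have l: "v 1 \<in> ?P l" using assms(8) incl[OF one] by blast
  then have l_verts: "l \<in> verts T" by (rule path_verts_imp_verts)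
  have R: "w \<in> R \<longleftrightarrow> (\<exists>i\<in>{2..d}. v i \<in> ?P w) \<or>
      w \<noteq> v 1 \<and> v 1 \<in> ?P w \<and> w \<notin> path_verts T (v 1) l" for w
    unfolding R_def using incl by (auto simp: descendants_def)
  have S_iff: "w \<in> S \<longleftrightarrow> w \<in> verts T \<and> (\<forall>i\<in>{2..d}. v i \<notin> ?P w) \<and>
      (v 1 \<in> ?P w \<longrightarrow> w = v 1 \<or> w \<in> path_verts T (v 1) l)" for w
    unfolding S_def using R by blast
  have R_branch: "\<exists>i\<in>{1..d}. v i \<in> ?P w" if "w \<in> R" for w
    using that one unfolding R by force
  \<comment> \<open>Two ancestors of \<open>w\<close> are comparable, and comparable children of the
    root coincide, against injectivity of \<open>v\<close>. This ensures that \<open>l\<close>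
    survives the deletion of the other branches.\<close>
  have disjoint: False if i: "i \<in> {2..d}" and w: "v 1 \<in> ?P w" "v i \<in> ?P w" for i w
  proof -
    have i': "i \<in> {1..d}" using i by auto
    have "v 1 \<in> ?P (v i) \<or> v i \<in> ?P (v 1)" using path_verts_chain[OF w] .
    then have "v 1 = v i"
      using child_of_root(2,3)[OF child[OF one]] child_of_root(2,3)[OF child[OF i']] by auto
    then have "1 = i" using inj_onD[OF assms(4) _ one i'] by blast
    then show False using i by simp
  qed
  have x_S: "x \<in> S"
  proof -
    have "?P x = {x}"
      using path_verts_eq[of x "[]" x] root_in_verts by (simp add: apath_Nil_iff)
    then have "v i \<notin> ?P x" if "i \<in> {1..d}" for i using child_of_root(2)[OF child[OF that]] by blast
    then show ?thesis using R_branch root_in_verts unfolding S_def by blast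
  qed
  have l_S: "l \<in> S"
  proof -
    have "l \<in> path_verts T (v 1) l"
      using endpoints_in_path_verts(2) child_of_root(1)[OF child[OF one]] l_verts by blast
    then show ?thesis using disjoint l l_verts unfolding S_iff by blast
  qed
  \<comment> \<open>A kept vertex in the branch of \<open>v 1\<close> is an ancestor of
    \<open>l\<close>, and hence so are all its ancestors; those of them in this branch lie on the
    path from \<open>v 1\<close> to \<open>l\<close>.\<close>
  have closed: "?P w \<subseteq> S" if w: "w \<in> S" for w
  proof
    fix z assume z: "z \<in> ?P w"
    have up: "?P z \<subseteq> ?P w" using path_verts_subset[OF z] .
    have "z \<in> path_verts T (v 1) l" if "v 1 \<in> ?P z"
    proof -
      have "v 1 \<in> ?P w" using that up by blast
      then have "w = v 1 \<or> w \<in> path_verts T (v 1) l" using w unfolding S_iff by blast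
      then have "w \<in> ?P l" using l path_verts_iff[OF l] by blast
      then show ?thesis using z that path_verts_subset path_verts_iff[OF l] by blast
    qed
    moreover have "v i \<notin> ?P z" if "i \<in> {2..d}" for i
      using that up w unfolding S_iff by blast
    ultimately show "z \<in> S" using path_verts_imp_verts(1)[OF z] unfolding S_iff by blast
  qed
  \<comment> \<open>Pruning does not change which kept vertices are within \<open>k\<close> of each
    other, so all further estimates can be made in \<open>T\<close>.\<close>
  have near: "b \<in> closed_nbhd T\<^sub>1 k a \<longleftrightarrow> b \<in> closed_nbhd T k a" if "a \<in> S" "b \<in> S" for a b
    unfolding T\<^sub>1 using closed_nbhd_induce_subgraph[OF S closed that] .
  have depth: "w \<in> closed_nbhd T (k div 2) x" if "i \<in> {1..d}" "v i \<in> ?P w" for i w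
    using assms(6) that incl path_verts_imp_verts(2) unfolding closed_nbhd_def by blast
  \<comment> \<open>The detour through \<open>x\<close> has length at most
    \<open>2 * (k div 2)\<close>, which is at most \<open>k\<close>.\<close>
  have branch_near: "b \<in> closed_nbhd T k a"
    if "i \<in> {1..d}" "v i \<in> ?P a" "j \<in> {1..d}" "v j \<in> ?P b" for i j a b
    using closed_nbhd_mono[OF closed_nbhd_trans[OF closed_nbhd_sym[OF depth[OF that(1,2)]]
      depth[OF that(3,4)]], of k] by simp
  \<comment> \<open>If \<open>b\<close> is in the branch of \<open>a\<close>, its depth is small
    enough. Otherwise the walk from \<open>a\<close> to \<open>b\<close> passes through
    \<open>x\<close>, and its final piece is a short enough walk from \<open>x\<close>.\<close>
  have from_root: "b \<in> closed_nbhd T k x"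
    if i: "i \<in> {1..d}" "v i \<in> ?P a" and ab: "b \<in> closed_nbhd T k a" for i a b
  proof (cases "v i \<in> ?P b")
    case True
    from closed_nbhd_mono[OF depth[OF i(1) this]] show ?thesis by simp
  next
    case False
    obtain p where p: "awalk a p b" "length p \<le> k" using ab unfolding closed_nbhd_iff by blast
    obtain p\<^sub>1 p\<^sub>2 where "p = p\<^sub>1 @ p\<^sub>2" "awalk x p\<^sub>2 b"
      using awalk_leaving_branch[OF child[OF i(1)] p(1) i(2) False] by blast
    then show ?thesis using p(2) unfolding closed_nbhd_iff by auto
  qed
  \<comment> \<open>Outside the branch of \<open>v 1\<close>, a walk from \<open>l\<close> to
    \<open>b\<close> passes through \<open>x\<close>. Reaching \<open>x\<close> takes at least
    \<open>k div 2\<close> arcs, by the exact distance of \<open>l\<close>, so at most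
    \<open>k - k div 2\<close> remain from \<open>x\<close> to \<open>b\<close>; from
    \<open>a\<close> to \<open>x\<close> the distance is at most \<open>k div 2\<close>.\<close>
  have from_leaf: "b \<in> closed_nbhd T k a"
    if i: "i \<in> {1..d}" "v i \<in> ?P a" and lb: "b \<in> closed_nbhd T k l" for i a b
  proof (cases "v 1 \<in> ?P b")
    case True
    then show ?thesis using branch_near i one by blast
  next
    case False
    obtain p where p: "awalk l p b" "length p \<le> k" using lb unfolding closed_nbhd_iff by blast
    obtain p\<^sub>1 p\<^sub>2 where p12: "p = p\<^sub>1 @ p\<^sub>2" "awalk l p\<^sub>1 x" "awalk x p\<^sub>2 b"
      using awalk_leaving_branch[OF child[OF one] p(1) l False] by blast
    obtain s where s: "awalk x s l" "length s = length p\<^sub>1" using awalk_rev[OF p12(2)] by blast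
    then have "graph_dist T x l \<le> ereal (real (length p\<^sub>1))" using graph_dist_le_iff by auto
    then have "k div 2 \<le> length p\<^sub>1" using assms(9) by simp
    then have "k div 2 + length p\<^sub>2 \<le> k" using p(2) p12(1) by simp
    moreover have "b \<in> closed_nbhd T (length p\<^sub>2) x"
      using p12(3) unfolding closed_nbhd_iff by blast
    ultimately show ?thesis
      using closed_nbhd_mono closed_nbhd_trans closed_nbhd_sym[OF depth[OF i]] by blast
  qed

  txt \<open>Guards of \<open>T\<close> on deleted vertices are moved to \<open>x\<close>.\<close>
  let ?f = "\<lambda>w. if w \<in> R then x else w"
  have f: "?f w \<in> S" if "w \<in> verts T" for w using that x_S unfolding S_def by simp
  have pres: "?f b \<in> closed_nbhd T\<^sub>1 k (?f a)"
    if a: "a \<in> verts T" and ab: "b \<in> closed_nbhd T k a" for a b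
  proof -
    have b: "b \<in> verts T" using ab by (simp add: closed_nbhd_def)
    have "?f b \<in> closed_nbhd T k (?f a)"
    proof (cases "a \<in> R"; cases "b \<in> R")
      assume "a \<in> R" "b \<in> R"
      then show ?thesis using self_in_closed_nbhd[OF root_in_verts] by simp
    next
      assume R': "a \<in> R" "b \<notin> R"
      then have "b \<in> closed_nbhd T k x" using R_branch from_root ab by blast
      then show ?thesis using R' by simp
    next
      assume R': "a \<notin> R" "b \<in> R"
      then have "a \<in> closed_nbhd T k x" using R_branch from_root closed_nbhd_sym[OF ab] by blast
      then show ?thesis using R' closed_nbhd_sym by simp
    qed (use ab in simp)
    then show ?thesis using near f a b by blast
  qed
  txt \<open>An attack on a deleted vertex of \<open>T\<close> is answered as an attack on \<open>l\<close>. This is sound because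
    \<open>l\<close> is deepest: whatever is within distance \<open>k\<close> of \<open>l\<close> is so for every deleted vertex.\<close>
  let ?h = "\<lambda>w. if w \<in> R then l else w"
  have h: "?h w \<in> S" if "w \<in> verts T" for w using that l_S unfolding S_def by simp
  have refl: "b \<in> closed_nbhd T k a"
    if a: "a \<in> verts T" and b: "b \<in> verts T" and "?h b \<in> closed_nbhd T\<^sub>1 k (?h a)" for a b
  proof -
    have hab: "?h b \<in> closed_nbhd T k (?h a)" using that(3) near[OF h[OF a] h[OF b]] by blast
    show ?thesis
    proof (cases "a \<in> R"; cases "b \<in> R")
      assume "a \<in> R" "b \<in> R"
      then show ?thesis using R_branch branch_near by blast
    next
      assume R': "a \<in> R" "b \<notin> R"
      then have "b \<in> closed_nbhd T k l" using hab by simp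
      then show ?thesis using R_branch from_leaf R' by blast
    next
      assume R': "a \<notin> R" "b \<in> R"
      then have "a \<in> closed_nbhd T k l" using closed_nbhd_sym[OF hab] by simp
      then show ?thesis using R_branch from_leaf R' closed_nbhd_sym by blast
    qed (use hab in simp)
  qed
  have surj: "?f ` verts T = verts T\<^sub>1" using f S unfolding T\<^sub>1 S_def by force
  have wf: "wf_digraph T\<^sub>1" unfolding T\<^sub>1 by (rule wellformed_induce_subgraph)
  have sub: "verts T\<^sub>1 \<subseteq> verts T" "?h ` verts T \<subseteq> verts T\<^sub>1"
    using S image_subsetI[of "verts T" ?h S, OF h] unfolding T\<^sub>1 by simp_all
  have id: "?h w = w" if "w \<in> verts T\<^sub>1" for w using that unfolding T\<^sub>1 S_def by simp
  \<comment> \<open>Both transports preserve the number of guards, so the two trees admit families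
    for the same values of \<open>q\<close>, and the least such values agree.\<close>
  have "(\<exists>\<E>. eternal_family T\<^sub>1 k q \<E>) \<longleftrightarrow> (\<exists>\<E>. eternal_family T k q \<E>)" for q
    using eternal_family_image[OF _ surj pres] eternal_family_preimage[OF _ wf sub id refl]
    by blast
  then show ?thesis unfolding eternal_dom_number_def by simp
qed

end
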